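(* Let $\kappa\ge1$, $E_\kappa=\{0,1,\dots,\kappa\}$, and let $A$ be a probabilistic cellular automaton on $\mathbb{Z}$ with state set $E_\kappa$, neighbourhood $N(x)=(x,x+1)$ and transition matrix $T$, seen as acting on probability laws on $E_\kappa^{\mathsf{HZ}}$ (horizontal zigzag). Let $(D,U)$ be a pair of Markov kernels on $E_\kappa$ such that $(DU)_{a,b}>0$ for all $a,b\in E_\kappa$. The law of the $(D,U)$-HZMC is invariant by $A$ if and only if the two following conditions are satisfied: (1) for all $a,b,c\in E_\kappa$: if $T_{(a,b),c}>0$ then $T_{(a,b),c}=\dfrac{D_{a,c}U_{c,b}}{(DU)_{a,b}}$, and if $T_{(a,b),c}=0$ then $D_{a,c}U_{c,b}=0$; (2) $DU=UD$.
   Context: A transition matrix is an array $T=(T_{(a,b),c})_{a,b,c\in E_\kappa}$ of non-negative numbers with $\sum_c T_{(a,b),c}=1$ for all $a,b$. The PCA with transition matrix $T$ on $\mathbb{Z}$ maps a (random) configuration $S_t\in E_\kappa^{\mathbb{Z}}$ to $S_{t+1}$ such that, conditionally on $S_t$ (and the past), the variables $S_{t+1}(x)$, $x\in\mathbb{Z}$, are independent and $S_{t+1}(x)=c$ with probability $T_{(S_t(x),S_t(x+1)),c}$. Action on the horizontal zigzag: a configuration on $\mathsf{HZ}$ is a pair $(S_0,S_1)\in E_\kappa^{\mathbb{Z}}\times E_\kappa^{\mathbb{Z}}$ of two consecutive lines. If $(S_0,S_1)$ has law $m$, the image of $m$ under $A$ is the law of $(S_1,S_2)$, where, conditionally on $(S_0,S_1)$,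 the $S_2(x)$ are independent with $S_2(x)=c$ with probability $T_{(S_1(x),S_1(x+1)),c}$. The law $m$ is invariant if it equals its image. A Markov kernel on $E_\kappa$ is a row-stochastic matrix indexed by $E_\kappa\times E_\kappa$. Given Markov kernels $D,U$ and a probability $\rho$ on $E_\kappa$ with $\rho=\rho DU$ (unique when all entries of $DU$ are positive), a $(D,U)$-HZMC is a pair $(S_0,S_1)$ such that for all $i_0\in\mathbb{Z}$, $n\ge0$ and $a_i,b_i\in E_\kappa$, $$\mathbb{P}(S_0(i_0+i)=a_i,\ S_1(i_0+i)=b_i,\ 0\le i\le n)=\rho_{a_0}\Big(\prod_{i=0}^{n-1}D_{a_i,b_i}U_{b_i,a_{i+1}}\Big)D_{a_n,b_n}.$$ *)

theory Defs
  imports "HOL-Probability.Probability"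
begin

text \<open>
  The state set is \<open>{..\<kappa>} = {0, \<dots>, \<kappa>}\<close>, a subset of type \<^typ>\<open>nat\<close>. Matrices are functions of
  which only the entries with indices in \<open>{..\<kappa>}\<close> are ever constrained or used.
\<close>

definition transition_matrix :: "nat \<Rightarrow> (nat \<times> nat \<Rightarrow> nat \<Rightarrow> real) \<Rightarrow> bool" where
  "transition_matrix \<kappa> T \<longleftrightarrow>
     (\<forall>a\<le>\<kappa>. \<forall>b\<le>\<kappa>. (\<forall>c\<le>\<kappa>. 0 \<le> T (a, b) c) \<and> (\<Sum>c\<le>\<kappa>. T (a, b) c) = 1)"

definition markov_kernel :: "nat \<Rightarrow> (nat \<Rightarrow> nat \<Rightarrow> real) \<Rightarrow> bool" where
  "markov_kernel \<kappa> K \<longleftrightarrow> (\<forall>a\<le>\<kappa>. (\<forall>b\<le>\<kappa>. 0 \<le> K a b) \<and> (\<Sum>b\<le>\<kappa>. K a b) = 1)"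

definition kernel_mult ::
  "nat \<Rightarrow> (nat \<Rightarrow> nat \<Rightarrow> real) \<Rightarrow> (nat \<Rightarrow> nat \<Rightarrow> real) \<Rightarrow> nat \<Rightarrow> nat \<Rightarrow> real" where
  "kernel_mult \<kappa> K L a b = (\<Sum>c\<le>\<kappa>. K a c * L c b)"

definition invariant_probability :: "nat \<Rightarrow> (nat \<Rightarrow> nat \<Rightarrow> real) \<Rightarrow> (nat \<Rightarrow> real) \<Rightarrow> bool" where
  "invariant_probability \<kappa> K \<rho> \<longleftrightarrow>
     (\<forall>a\<le>\<kappa>. 0 \<le> \<rho> a) \<and> (\<Sum>a\<le>\<kappa>. \<rho> a) = 1 \<and> (\<forall>b\<le>\<kappa>. \<rho> b = (\<Sum>a\<le>\<kappa>. \<rho> a * K a b))"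

definition line_space :: "nat \<Rightarrow> (int \<Rightarrow> nat) measure" where
  "line_space \<kappa> = (\<Pi>\<^sub>M x\<in>UNIV. count_space {..\<kappa>})"

text \<open>
  A configuration on the horizontal zigzag is a pair of consecutive lines. As with
  \<^const>\<open>line_space\<close>, only the measurable structure of this measure is relevant.
\<close>

definition zigzag_space :: "nat \<Rightarrow> ((int \<Rightarrow> nat) \<times> (int \<Rightarrow> nat)) measure" where
  "zigzag_space \<kappa> = line_space \<kappa> \<Otimes>\<^sub>M line_space \<kappa>"

text \<open>The conditional law of the next line of the PCA given that the current line is \<open>s\<close>.\<close>

definition pca_step :: "nat \<Rightarrow> (nat \<times> nat \<Rightarrow> nat \<Rightarrow> real) \<Rightarrow> (int \<Rightarrow> nat) \<Rightarrow> (int \<Rightarrow> nat) measure" where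
  "pca_step \<kappa> T s =
     (\<Pi>\<^sub>M x\<in>UNIV. point_measure {..\<kappa>} (\<lambda>c. ennreal (T (s x, s (x + 1)) c)))"

text \<open>The law of \<open>(S\<^sub>1, S\<^sub>2)\<close> when \<open>(S\<^sub>0, S\<^sub>1)\<close> has law \<open>m\<close>.\<close>

definition pca_zigzag :: "nat \<Rightarrow> (nat \<times> nat \<Rightarrow> nat \<Rightarrow> real) \<Rightarrow>
    ((int \<Rightarrow> nat) \<times> (int \<Rightarrow> nat)) measure \<Rightarrow> ((int \<Rightarrow> nat) \<times> (int \<Rightarrow> nat)) measure" where
  "pca_zigzag \<kappa> T m =
     m \<bind> (\<lambda>(s0, s1). distr (pca_step \<kappa> T s1) (zigzag_space \<kappa>) (\<lambda>s2. (s1, s2)))"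

definition hzmc_law :: "nat \<Rightarrow> (nat \<Rightarrow> real) \<Rightarrow> (nat \<Rightarrow> nat \<Rightarrow> real) \<Rightarrow> (nat \<Rightarrow> nat \<Rightarrow> real) \<Rightarrow>
    ((int \<Rightarrow> nat) \<times> (int \<Rightarrow> nat)) measure \<Rightarrow> bool" where
  "hzmc_law \<kappa> \<rho> D U m \<longleftrightarrow>
     prob_space m \<and> sets m = sets (zigzag_space \<kappa>) \<and>
     (\<forall>(i0::int) (n::nat) (a::nat \<Rightarrow> nat) (b::nat \<Rightarrow> nat).
        (\<forall>i\<le>n. a i \<le> \<kappa> \<and> b i \<le> \<kappa>) \<longrightarrow>
        measure m {(s0, s1) \<in> space m.
            \<forall>i\<le>n. s0 (i0 + int i) = a i \<and> s1 (i0 + int i) = b i} =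
          \<rho> (a 0) * (\<Prod>i<n. D (a i) (b i) * U (b i) (a (Suc i))) * D (a n) (b n))"

end

(*
  The second line of a (D,U)-HZMC is a Markov chain with initial law rho D and kernel UD, so the image
  law gives a pair of words (a, b) of length n + 1 the probability
    sum_c (rho D)(a_0) prod_{i<=n} UD(a_i, a_{i+1}) T((a_i, a_{i+1}), b_i),   with a_{n+1} = c,
  and invariance means that this equals the HZMC probability for all windows.

  If it does, summing out b_0 for n = 0 gives rho = rho D; summing out b_1 for n = 1 and dividing by
  rho(a_0) > 0 gives UD(a_0, a_1) T((a_0, a_1), b_0) = D(a_0, b_0) U(b_0, a_1), and summing over b_0 then
  gives UD = DU. Conversely, if DU = UD then rho D is invariant under DU, hence equals rho by uniqueness
  for a positive kernel, and the two products agree factor by factor.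
*)
theory Submission imports Defs begin

subsection \<open>Laws on the zigzag\<close>

text \<open>The two word probabilities differ at the right end of the window: an HZMC word ends with
  D(a_n, b_n), while the image word depends on one further letter c, which is averaged out. Once the
  local identity between T, D and U is known, the rows of U absorb c. When only the word
  probabilities are known, summing over the last letter b_n removes the boundary instead: D(a_n,
  b_n) and the sum over c of UD(a_n, c) T((a_n, c), b_n) are both turned into 1, and the window n =
  1 is left with one local factor on each side.

  Equality of laws on an infinite product has to be reduced to word probabilities as well. Dynkin's
  theorem is applied to the events that depend on finitely many coordinates; each is a finite
  disjoint union of cylinders over a single window large enough to contain these
  coordinates.\<close>

lemma emeasure_split_finite:
  assumes "finite V" and "\<And>\<omega>. \<omega> \<in> space M \<Longrightarrow> f \<omega> \<in> V"
    and "\<And>v. v \<in> V \<Longrightarrow> {\<omega> \<in> space M. f \<omega> = v \<and> P \<omega>} \<in> sets M"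
  shows "{\<omega> \<in> space M. P \<omega>} \<in> sets M"
    and "emeasure M {\<omega> \<in> space M. P \<omega>} = (\<Sum>v\<in>V. emeasure M {\<omega> \<in> space M. f \<omega> = v \<and> P \<omega>})"
proof -
  have eq: "{\<omega> \<in> space M. P \<omega>} = (\<Union>v\<in>V. {\<omega> \<in> space M. f \<omega> = v \<and> P \<omega>})"
    using assms(2) by auto
  show "{\<omega> \<in> space M. P \<omega>} \<in> sets M"
    unfolding eq using assms by (intro sets.finite_UN) auto
  show "emeasure M {\<omega> \<in> space M. P \<omega>} = (\<Sum>v\<in>V. emeasure M {\<omega> \<in> space M. f \<omega> = v \<and> P \<omega>})"
    unfolding eq using assms
    by (intro sum_emeasure[symmetric]) (auto simp: disjoint_family_on_def)
qed

section \<open>Windows, words and cylinders\<close>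

text \<open>Cut out of the space of \<open>zigzag_space \<kappa>\<close> rather than of a given law,
  so that one and the same set is evaluated under \<open>m\<close> and under its image. The bound
  \<open>n\<close> is the last index: the window has n + 1 positions.\<close>

definition cylinder :: "nat \<Rightarrow> int \<Rightarrow> nat \<Rightarrow> (nat \<Rightarrow> nat) \<Rightarrow> (nat \<Rightarrow> nat) \<Rightarrow>
    ((int \<Rightarrow> nat) \<times> (int \<Rightarrow> nat)) set" where
  "cylinder \<kappa> i0 n a b = {\<omega> \<in> space (zigzag_space \<kappa>).
     \<forall>i\<le>n. fst \<omega> (i0 + int i) = a i \<and> snd \<omega> (i0 + int i) = b i}"

text \<open>The restriction makes the value extensional, hence an element of the finite set
  \<open>words \<kappa> n\<close> over which probabilities can be summed.\<close>

definition window :: "int \<Rightarrow> nat \<Rightarrow> (int \<Rightarrow> nat) \<Rightarrow> nat \<Rightarrow> nat" where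
  "window i0 n s = (\<lambda>i\<in>{..n}. s (i0 + int i))"

abbreviation words :: "nat \<Rightarrow> nat \<Rightarrow> (nat \<Rightarrow> nat) set" where
  "words \<kappa> n \<equiv> {..n} \<rightarrow>\<^sub>E {..\<kappa>}"

lemma finite_words [simp]: "finite (words \<kappa> n)"
  by (intro finite_PiE) auto

lemma space_line: "space (line_space \<kappa>) = {s. \<forall>x. s x \<le> \<kappa>}"
  by (auto simp: line_space_def space_PiM PiE_def Pi_def)

lemma space_zigzag: "space (zigzag_space \<kappa>) = {\<omega>. \<forall>x. fst \<omega> x \<le> \<kappa> \<and> snd \<omega> x \<le> \<kappa>}"
  by (auto simp: zigzag_space_def space_pair_measure space_line)

lemma window_in_words: "(\<And>x. s x \<le> \<kappa>) \<Longrightarrow> window i0 n s \<in> words \<kappa> n"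
  by (auto simp: window_def)

lemma window_eq_iff: "a \<in> words \<kappa> n \<Longrightarrow> window i0 n s = a \<longleftrightarrow> (\<forall>i\<le>n. s (i0 + int i) = a i)"
  by (auto simp: window_def fun_eq_iff restrict_def PiE_def extensional_def)

lemma line_component: "(\<lambda>s. s x) \<in> line_space \<kappa> \<rightarrow>\<^sub>M count_space {..\<kappa>}"
  unfolding line_space_def by (rule measurable_component_singleton) simp

lemma line_component_UNIV: "(\<lambda>s. s x) \<in> line_space \<kappa> \<rightarrow>\<^sub>M count_space UNIV"
  by (rule measurable_compose[OF line_component]) simp

lemma zigzag_fst: "fst \<in> zigzag_space \<kappa> \<rightarrow>\<^sub>M line_space \<kappa>"
  and zigzag_snd: "snd \<in> zigzag_space \<kappa> \<rightarrow>\<^sub>M line_space \<kappa>"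
  unfolding zigzag_space_def by (rule measurable_fst measurable_snd)+

lemma zigzag_component_sets:
  "{\<omega> \<in> space (zigzag_space \<kappa>). fst \<omega> x = c} \<in> sets (zigzag_space \<kappa>)"
  "{\<omega> \<in> space (zigzag_space \<kappa>). snd \<omega> x = c} \<in> sets (zigzag_space \<kappa>)"
  using measurable_sets[OF measurable_compose[OF zigzag_fst line_component_UNIV], of "{c}"]
    measurable_sets[OF measurable_compose[OF zigzag_snd line_component_UNIV], of "{c}"]
  by (simp_all add: vimage_def Int_def conj_commute)

lemma cylinder_sets: "cylinder \<kappa> i0 n a b \<in> sets (zigzag_space \<kappa>)"
proof -
  have "cylinder \<kappa> i0 n a b = {\<omega> \<in> space (zigzag_space \<kappa>).
      \<forall>i\<in>{..n}. fst \<omega> (i0 + int i) = a i \<and> snd \<omega> (i0 + int i) = b i}"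
    by (auto simp: cylinder_def)
  also have "\<dots> \<in> sets (zigzag_space \<kappa>)"
    by (intro sets.sets_Collect_finite_All sets.sets_Collect_conj zigzag_component_sets) auto
  finally show ?thesis .
qed

text \<open>Events depending on finitely many coordinates; unlike the cylinders over windows of different
  lengths, they are closed under intersection.\<close>

definition local_events :: "nat \<Rightarrow> ((int \<Rightarrow> nat) \<times> (int \<Rightarrow> nat)) set set" where
  "local_events \<kappa> = {A. A \<subseteq> space (zigzag_space \<kappa>) \<and>
     (\<exists>N::nat. \<forall>\<omega>\<in>space (zigzag_space \<kappa>). \<forall>\<omega>'\<in>space (zigzag_space \<kappa>).
        (\<forall>x. \<bar>x\<bar> \<le> int N \<longrightarrow> fst \<omega> x = fst \<omega>' x \<and> snd \<omega> x = snd \<omega>' x) \<longrightarrow> \<omega> \<in> A \<longrightarrow> \<omega>' \<in> A)}"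

lemma Int_stable_local_events: "Int_stable (local_events \<kappa>)"
proof (rule Int_stableI)
  fix A B assume "A \<in> local_events \<kappa>" "B \<in> local_events \<kappa>"
  then obtain N N' :: nat where sub: "A \<subseteq> space (zigzag_space \<kappa>)"
    and N: "\<And>\<omega> \<omega>'. \<omega> \<in> space (zigzag_space \<kappa>) \<Longrightarrow> \<omega>' \<in> space (zigzag_space \<kappa>) \<Longrightarrow>
      (\<forall>x. \<bar>x\<bar> \<le> int N \<longrightarrow> fst \<omega> x = fst \<omega>' x \<and> snd \<omega> x = snd \<omega>' x) \<Longrightarrow> \<omega> \<in> A \<Longrightarrow> \<omega>' \<in> A"
    and N': "\<And>\<omega> \<omega>'. \<omega> \<in> space (zigzag_space \<kappa>) \<Longrightarrow> \<omega>' \<in> space (zigzag_space \<kappa>) \<Longrightarrow>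
      (\<forall>x. \<bar>x\<bar> \<le> int N' \<longrightarrow> fst \<omega> x = fst \<omega>' x \<and> snd \<omega> x = snd \<omega>' x) \<Longrightarrow> \<omega> \<in> B \<Longrightarrow> \<omega>' \<in> B"
    unfolding local_events_def by blast
  show "A \<inter> B \<in> local_events \<kappa>"
    unfolding local_events_def
  proof (intro CollectI conjI exI[of _ "max N N'"] ballI impI)
    show "A \<inter> B \<subseteq> space (zigzag_space \<kappa>)" using sub by auto
  next
    fix \<omega> \<omega>' assume *: "\<omega> \<in> space (zigzag_space \<kappa>)" "\<omega>' \<in> space (zigzag_space \<kappa>)"
      "\<forall>x. \<bar>x\<bar> \<le> int (max N N') \<longrightarrow> fst \<omega> x = fst \<omega>' x \<and> snd \<omega> x = snd \<omega>' x" "\<omega> \<in> A \<inter> B"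
    then show "\<omega>' \<in> A \<inter> B"
      by (intro IntI N[OF *(1,2)] N'[OF *(1,2)]) auto
  qed
qed

text \<open>If \<open>A\<close> depends only on the positions from -N to N, the window starting at
  -N with last index 2N sees all of them. Two configurations in one cylinder over this window agree
  there, so \<open>A\<close> contains the whole cylinder or misses it.\<close>

lemma local_event_window_cases:
  assumes "A \<in> local_events \<kappa>"
  obtains i0 n where "\<And>a b. a \<in> words \<kappa> n \<Longrightarrow> b \<in> words \<kappa> n \<Longrightarrow>
    {\<omega> \<in> space (zigzag_space \<kappa>). (window i0 n (fst \<omega>), window i0 n (snd \<omega>)) = (a, b) \<and> \<omega> \<in> A}
      \<in> {{}, cylinder \<kappa> i0 n a b}"
proof -
  from assms obtain N :: nat where
    N: "\<And>\<omega> \<omega>'. \<omega> \<in> space (zigzag_space \<kappa>) \<Longrightarrow> \<omega>' \<in> space (zigzag_space \<kappa>) \<Longrightarrow>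
      (\<forall>x. \<bar>x\<bar> \<le> int N \<longrightarrow> fst \<omega> x = fst \<omega>' x \<and> snd \<omega> x = snd \<omega>' x) \<Longrightarrow> \<omega> \<in> A \<Longrightarrow> \<omega>' \<in> A"
    unfolding local_events_def by blast
  show thesis
  proof (rule that[of "2 * N" "- int N"])
    fix a b assume ab: "a \<in> words \<kappa> (2 * N)" "b \<in> words \<kappa> (2 * N)"
    let ?C = "cylinder \<kappa> (- int N) (2 * N) a b"
    have eq: "{\<omega> \<in> space (zigzag_space \<kappa>). (window (- int N) (2 * N) (fst \<omega>),
        window (- int N) (2 * N) (snd \<omega>)) = (a, b) \<and> \<omega> \<in> A} = ?C \<inter> A"
      using ab by (auto simp: window_eq_iff cylinder_def)
    have "\<omega>' \<in> A" if "\<omega> \<in> ?C" "\<omega> \<in> A" "\<omega>' \<in> ?C" for \<omega> \<omega>'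
    proof (rule N[of \<omega> \<omega>'])
      show "\<forall>x. \<bar>x\<bar> \<le> int N \<longrightarrow> fst \<omega> x = fst \<omega>' x \<and> snd \<omega> x = snd \<omega>' x"
      proof (intro allI impI)
        fix x :: int assume "\<bar>x\<bar> \<le> int N"
        then have "nat (x + int N) \<le> 2 * N" "x = - int N + int (nat (x + int N))" by auto
        then show "fst \<omega> x = fst \<omega>' x \<and> snd \<omega> x = snd \<omega>' x"
          using that unfolding cylinder_def by (metis (mono_tags, lifting) mem_Collect_eq)
      qed
    qed (use that in \<open>auto simp: cylinder_def\<close>)
    then show "{\<omega> \<in> space (zigzag_space \<kappa>). (window (- int N) (2 * N) (fst \<omega>),
        window (- int N) (2 * N) (snd \<omega>)) = (a, b) \<and> \<omega> \<in> A} \<in> {{}, ?C}"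
      unfolding eq by blast
  qed
qed

text \<open>The window and the set \<open>X\<close> of word pairs are chosen before the measure
  \<open>M\<close>, so that two laws can be compared term by term on the same decomposition.\<close>

lemma local_event_decomposition:
  assumes "A \<in> local_events \<kappa>"
  obtains i0 n X where "X \<subseteq> words \<kappa> n \<times> words \<kappa> n"
    and "A \<in> sets (zigzag_space \<kappa>)"
    and "\<And>M. sets M = sets (zigzag_space \<kappa>) \<Longrightarrow>
      emeasure M A = (\<Sum>(a, b)\<in>X. emeasure M (cylinder \<kappa> i0 n a b))"
proof -
  obtain n i0 where *: "\<And>a b. a \<in> words \<kappa> n \<Longrightarrow> b \<in> words \<kappa> n \<Longrightarrow>
    {\<omega> \<in> space (zigzag_space \<kappa>). (window i0 n (fst \<omega>), window i0 n (snd \<omega>)) = (a, b) \<and> \<omega> \<in> A}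
      \<in> {{}, cylinder \<kappa> i0 n a b}"
    by (rule local_event_window_cases[OF assms]) (rule that)
  let ?V = "words \<kappa> n \<times> words \<kappa> n"
  define W where "W = (\<lambda>\<omega>. (window i0 n (fst \<omega>), window i0 n (snd \<omega>)))"
  define Z where "Z = zigzag_space \<kappa>"
  let ?S = "\<lambda>v. {\<omega> \<in> space Z. W \<omega> = v \<and> \<omega> \<in> A}"
  \<comment> \<open>By the dichotomy, a nonempty piece is a full cylinder; the empty pieces
    contribute 0 to the sum.\<close>
  let ?X = "{v \<in> ?V. ?S v \<noteq> {}}"
  have S_cases: "?S v \<in> {{}, cylinder \<kappa> i0 n (fst v) (snd v)}" if "v \<in> ?V" for v
    using *[of "fst v" "snd v"] that by (simp add: W_def Z_def mem_Times_iff)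
  have A: "{\<omega> \<in> space Z. \<omega> \<in> A} = A"
    using assms by (auto simp: local_events_def Z_def)
  have V: "W \<omega> \<in> ?V" if "\<omega> \<in> space Z" for \<omega>
    using that unfolding W_def Z_def
    by (intro SigmaI window_in_words) (simp_all add: space_zigzag)
  have S: "?S v \<in> sets Z" if "v \<in> ?V" for v
  proof -
    consider "?S v = {}" | "?S v = cylinder \<kappa> i0 n (fst v) (snd v)" using S_cases[OF \<open>v \<in> ?V\<close>] by blast
    then show ?thesis
      by cases (simp_all only: sets.empty_sets cylinder_sets Z_def)
  qed
  have fin: "finite ?V" by simp
  show thesis
  proof (rule that[of ?X n i0])
    show "?X \<subseteq> ?V" by (rule Collect_subset)
    show "A \<in> sets (zigzag_space \<kappa>)"
    proof -
      have "{\<omega> \<in> space Z. \<omega> \<in> A} \<in> sets Z"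
        by (rule emeasure_split_finite(1)[OF fin, where f = W]) (erule V, erule S)
      then show ?thesis unfolding A unfolding Z_def .
    qed
  next
    fix M :: "((int \<Rightarrow> nat) \<times> (int \<Rightarrow> nat)) measure" assume M: "sets M = sets (zigzag_space \<kappa>)"
    then have M: "sets M = sets Z" unfolding Z_def .
    have sp: "space M = space Z" using M by (rule sets_eq_imp_space_eq)
    have "emeasure M A = (\<Sum>v\<in>?V. emeasure M (?S v))"
      by (rule emeasure_split_finite(2)[of ?V M W "\<lambda>\<omega>. \<omega> \<in> A", unfolded sp M A, OF fin])
        (erule V, erule S)
    also have "\<dots> = (\<Sum>v\<in>?X. emeasure M (?S v))"
    proof (rule sum.mono_neutral_right[OF fin Collect_subset], rule ballI)
      fix v assume "v \<in> ?V - ?X"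
      then have "?S v = {}" by (simp only: Diff_iff mem_Collect_eq) argo
      then show "emeasure M (?S v) = 0" by (simp only: emeasure_empty)
    qed
    also have "\<dots> = (\<Sum>(a, b)\<in>?X. emeasure M (cylinder \<kappa> i0 n a b))"
    proof (rule sum.cong[OF refl])
      fix v assume "v \<in> ?X"
      then have "?S v = cylinder \<kappa> i0 n (fst v) (snd v)"
        using S_cases[of v] by (simp only: mem_Collect_eq) blast
      then show "emeasure M (?S v) = (case v of (a, b) \<Rightarrow> emeasure M (cylinder \<kappa> i0 n a b))"
        by (simp only: case_prod_beta)
    qed
    finally show "emeasure M A = (\<Sum>(a, b)\<in>?X. emeasure M (cylinder \<kappa> i0 n a b))" .
  qed
qed

text \<open>Local events are finite unions of cylinders, hence measurable. Conversely, every event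
  on one coordinate is local, so the identity is measurable from the generated sigma-algebra into
  the product one.\<close>

lemma sets_zigzag: "sets (zigzag_space \<kappa>) = sigma_sets (space (zigzag_space \<kappa>)) (local_events \<kappa>)"
proof
  have "local_events \<kappa> \<subseteq> sets (zigzag_space \<kappa>)"
    by (rule subsetI) (rule local_event_decomposition)
  then show "sigma_sets (space (zigzag_space \<kappa>)) (local_events \<kappa>) \<subseteq> sets (zigzag_space \<kappa>)"
    by (rule sets.sigma_sets_subset)
next
  define S where "S = sigma (space (zigzag_space \<kappa>)) (local_events \<kappa>)"
  have P: "local_events \<kappa> \<subseteq> Pow (space (zigzag_space \<kappa>))" by (auto simp: local_events_def)
  then have sp: "space S = space (zigzag_space \<kappa>)"
    and sets: "sets S = sigma_sets (space (zigzag_space \<kappa>)) (local_events \<kappa>)"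
    by (simp_all add: S_def space_measure_of sets_measure_of)
  \<comment> \<open>\<open>Q\<close> may look at either line; the event depends on the position
    \<open>x\<close> alone, so it is local with bound \<bar>x\<bar>.\<close>
  have gen: "{\<omega> \<in> space S. Q (fst \<omega> x) (snd \<omega> x)} \<in> sets S" for Q x
  proof -
    have "{\<omega> \<in> space S. Q (fst \<omega> x) (snd \<omega> x)} \<in> local_events \<kappa>"
      unfolding local_events_def sp by (auto intro!: exI[of _ "nat \<bar>x\<bar>"])
    then show ?thesis unfolding sets by auto
  qed
  have "fst \<in> S \<rightarrow>\<^sub>M line_space \<kappa>" "snd \<in> S \<rightarrow>\<^sub>M line_space \<kappa>"
    unfolding line_space_def
    using gen[of "\<lambda>u v. u \<in> A" for A] gen[of "\<lambda>u v. v \<in> A" for A]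
    by (auto intro!: measurable_PiM_single simp: sp space_zigzag)
  then have "id \<in> S \<rightarrow>\<^sub>M zigzag_space \<kappa>"
    unfolding zigzag_space_def by (intro measurable_pair) auto
  then have "sets (zigzag_space \<kappa>) \<subseteq> sets S"
    using measurable_sets[of id S "zigzag_space \<kappa>"] sets.sets_into_space[of _ "zigzag_space \<kappa>"]
    by (auto simp: sp Int_absorb2)
  then show "sets (zigzag_space \<kappa>) \<subseteq> sigma_sets (space (zigzag_space \<kappa>)) (local_events \<kappa>)"
    by (simp add: sets)
qed

text \<open>Dynkin's theorem for the local events. The whole space is itself local and of finite
  mass, so a constant sequence serves as the exhaustion.\<close>

lemma zigzag_measure_eqI:
  assumes "sets M = sets (zigzag_space \<kappa>)" "sets N = sets (zigzag_space \<kappa>)"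
    and "finite_measure M"
    and "\<And>i0 n a b. (\<And>i. i \<le> n \<Longrightarrow> a i \<le> \<kappa> \<and> b i \<le> \<kappa>) \<Longrightarrow>
      emeasure M (cylinder \<kappa> i0 n a b) = emeasure N (cylinder \<kappa> i0 n a b)"
  shows "M = N"
proof (rule measure_eqI_generator_eq[where A = "\<lambda>_. space (zigzag_space \<kappa>)"])
  interpret finite_measure M by fact
  show "emeasure M A = emeasure N A" if "A \<in> local_events \<kappa>" for A
  proof -
    obtain i0 n X where X: "X \<subseteq> words \<kappa> n \<times> words \<kappa> n" "A \<in> sets (zigzag_space \<kappa>)" "\<And>M. sets M = sets (zigzag_space \<kappa>) \<Longrightarrow>
      emeasure M A = (\<Sum>(a, b)\<in>X. emeasure M (cylinder \<kappa> i0 n a b))"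
      by (rule local_event_decomposition[OF \<open>A \<in> local_events \<kappa>\<close>]) (rule that)
    show ?thesis
      unfolding X(3)[OF assms(1)] X(3)[OF assms(2)]
      using X(1) by (intro sum.cong) (auto intro!: assms(4))
  qed
  show "emeasure M (space (zigzag_space \<kappa>)) \<noteq> \<infinity>" by simp
qed (use assms sets_zigzag Int_stable_local_events in \<open>auto simp: local_events_def\<close>)

subsection \<open>Kernels and word probabilities\<close>

text \<open>Some letter has positive mass because the total is 1, and a single step of a positive
  kernel carries part of that mass to every letter.\<close>

lemma invariant_probability_pos:
  assumes "\<And>a b. a \<le> \<kappa> \<Longrightarrow> b \<le> \<kappa> \<Longrightarrow> 0 < K a b" "invariant_probability \<kappa> K \<rho>" "b \<le> \<kappa>"
  shows "0 < \<rho> b"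
proof -
  have nonneg: "\<And>a. a \<le> \<kappa> \<Longrightarrow> 0 \<le> \<rho> a" and sum: "(\<Sum>a\<le>\<kappa>. \<rho> a) = 1"
    and inv: "\<rho> b = (\<Sum>a\<le>\<kappa>. \<rho> a * K a b)"
    using assms by (auto simp: invariant_probability_def)
  obtain a where a: "a \<le> \<kappa>" "\<rho> a \<noteq> 0"
  proof (rule ccontr)
    assume "\<not> thesis"
    then have "(\<Sum>a\<le>\<kappa>. \<rho> a) = 0" using that by (intro sum.neutral) auto
    with sum show False by simp
  qed
  have "0 < \<rho> a * K a b"
    using a nonneg[of a] assms(1)[of a b] assms(3) by simp
  also have "\<dots> \<le> (\<Sum>a\<le>\<kappa>. \<rho> a * K a b)"
    using a nonneg assms(1,3) by (intro member_le_sum) (auto simp: less_imp_le)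
  finally show ?thesis using inv by simp
qed

lemma invariant_probability_unique:
  assumes K: "\<And>a b. a \<le> \<kappa> \<Longrightarrow> b \<le> \<kappa> \<Longrightarrow> 0 < K a b"
    and \<rho>: "invariant_probability \<kappa> K \<rho>" and \<sigma>: "invariant_probability \<kappa> K \<sigma>" and "a \<le> \<kappa>"
  shows "\<rho> a = \<sigma> a"
proof -
  \<comment> \<open>With \<open>r\<close> the minimal ratio, \<open>\<rho> - r \<sigma>\<close> is nonnegative, invariant and vanishes at some \<open>z\<close>;
    positivity of column \<open>z\<close> of \<open>K\<close> makes it vanish everywhere.\<close>
  have pos: "0 < \<sigma> x" if "x \<le> \<kappa>" for x
    using K \<sigma> that by (rule invariant_probability_pos)
  define r where "r = Min ((\<lambda>a. \<rho> a / \<sigma> a) ` {..\<kappa>})"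
  have "r \<in> (\<lambda>a. \<rho> a / \<sigma> a) ` {..\<kappa>}" unfolding r_def by (intro Min_in) auto
  then obtain z where z: "z \<le> \<kappa>" "\<rho> z = r * \<sigma> z" using pos by force
  have nonneg: "0 \<le> \<rho> x - r * \<sigma> x" if "x \<le> \<kappa>" for x
  proof -
    have "r \<le> \<rho> x / \<sigma> x" unfolding r_def using that by (intro Min_le) auto
    then show ?thesis using pos[OF that] by (simp add: pos_le_divide_eq)
  qed
  have "(\<Sum>x\<le>\<kappa>. (\<rho> x - r * \<sigma> x) * K x z) = (\<Sum>x\<le>\<kappa>. \<rho> x * K x z) - r * (\<Sum>x\<le>\<kappa>. \<sigma> x * K x z)"
    by (simp add: left_diff_distrib sum_subtractf sum_distrib_left mult.assoc)
  also have "\<dots> = \<rho> z - r * \<sigma> z"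
    using \<rho> \<sigma> z(1) unfolding invariant_probability_def by metis
  finally have "(\<Sum>x\<le>\<kappa>. (\<rho> x - r * \<sigma> x) * K x z) = 0" using z by simp
  then have "\<forall>x\<in>{..\<kappa>}. (\<rho> x - r * \<sigma> x) * K x z = 0"
    by (subst (asm) sum_nonneg_eq_0_iff) (use nonneg K z in \<open>auto simp: less_imp_le\<close>)
  then have eq: "\<rho> x = r * \<sigma> x" if "x \<le> \<kappa>" for x using that K[of x z] z by fastforce
  then have "(\<Sum>x\<le>\<kappa>. \<rho> x) = r * (\<Sum>x\<le>\<kappa>. \<sigma> x)" by (simp add: sum_distrib_left)
  moreover have "(\<Sum>x\<le>\<kappa>. \<rho> x) = 1" "(\<Sum>x\<le>\<kappa>. \<sigma> x) = 1"
    using \<rho> \<sigma> unfolding invariant_probability_def by blast+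
  ultimately have "r = 1" by simp
  then show ?thesis using eq[OF \<open>a \<le> \<kappa>\<close>] by simp
qed

section \<open>Products of kernels and row vectors\<close>

lemma kernel_mult_nonneg:
  "markov_kernel \<kappa> K \<Longrightarrow> markov_kernel \<kappa> L \<Longrightarrow> a \<le> \<kappa> \<Longrightarrow> b \<le> \<kappa> \<Longrightarrow> 0 \<le> kernel_mult \<kappa> K L a b"
  unfolding kernel_mult_def markov_kernel_def by (intro sum_nonneg mult_nonneg_nonneg) auto

lemma sum_kernel_mult:
  assumes "markov_kernel \<kappa> K" "markov_kernel \<kappa> L" "a \<le> \<kappa>"
  shows "(\<Sum>b\<le>\<kappa>. kernel_mult \<kappa> K L a b) = 1"
proof -
  have "(\<Sum>b\<le>\<kappa>. kernel_mult \<kappa> K L a b) = (\<Sum>c\<le>\<kappa>. K a c * (\<Sum>b\<le>\<kappa>. L c b))"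
    unfolding kernel_mult_def sum_distrib_left by (rule sum.swap)
  also have "\<dots> = 1" using assms by (simp add: markov_kernel_def)
  finally show ?thesis .
qed

text \<open>The row vector \<open>\<rho> K\<close>. For \<open>K = D\<close> and the initial law
  \<open>\<rho>\<close> of a HZMC, it is the law of one letter of the second line.\<close>

definition push :: "nat \<Rightarrow> (nat \<Rightarrow> real) \<Rightarrow> (nat \<Rightarrow> nat \<Rightarrow> real) \<Rightarrow> nat \<Rightarrow> real" where
  "push \<kappa> \<rho> K b = (\<Sum>a\<le>\<kappa>. \<rho> a * K a b)"

lemma push_nonneg:
  "invariant_probability \<kappa> P \<rho> \<Longrightarrow> markov_kernel \<kappa> K \<Longrightarrow> b \<le> \<kappa> \<Longrightarrow> 0 \<le> push \<kappa> \<rho> K b"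
  unfolding push_def markov_kernel_def invariant_probability_def
  by (intro sum_nonneg mult_nonneg_nonneg) auto

lemma push_push: "push \<kappa> (push \<kappa> \<rho> K) L b = push \<kappa> \<rho> (kernel_mult \<kappa> K L) b"
proof -
  have "push \<kappa> (push \<kappa> \<rho> K) L b = (\<Sum>a\<le>\<kappa>. \<Sum>x\<le>\<kappa>. \<rho> x * K x a * L a b)"
    by (simp add: push_def sum_distrib_right)
  also have "\<dots> = (\<Sum>x\<le>\<kappa>. \<Sum>a\<le>\<kappa>. \<rho> x * K x a * L a b)" by (rule sum.swap)
  finally show ?thesis by (simp add: push_def kernel_mult_def sum_distrib_left mult.assoc)
qed

lemma push_cong:
  "(\<And>a. a \<le> \<kappa> \<Longrightarrow> \<rho> a = \<sigma> a) \<Longrightarrow> (\<And>a. a \<le> \<kappa> \<Longrightarrow> K a b = L a b) \<Longrightarrow> push \<kappa> \<rho> K b = push \<kappa> \<sigma> L b"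
  by (simp add: push_def)

text \<open>By associativity, (\<rho> D)(DU) = (\<rho> D)(UD) = (\<rho> DU) D = \<rho> D.\<close>

lemma push_invariant:
  assumes D: "markov_kernel \<kappa> D" and inv: "invariant_probability \<kappa> (kernel_mult \<kappa> D U) \<rho>"
    and comm: "\<And>a b. a \<le> \<kappa> \<Longrightarrow> b \<le> \<kappa> \<Longrightarrow> kernel_mult \<kappa> D U a b = kernel_mult \<kappa> U D a b"
  shows "invariant_probability \<kappa> (kernel_mult \<kappa> D U) (push \<kappa> \<rho> D)"
  unfolding invariant_probability_def
proof (intro conjI allI impI)
  show "0 \<le> push \<kappa> \<rho> D a" if "a \<le> \<kappa>" for a using push_nonneg[OF inv D that] .
  have "(\<Sum>a\<le>\<kappa>. push \<kappa> \<rho> D a) = (\<Sum>x\<le>\<kappa>. \<rho> x * (\<Sum>a\<le>\<kappa>. D x a))"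
    unfolding push_def sum_distrib_left by (rule sum.swap)
  also have "\<dots> = (\<Sum>x\<le>\<kappa>. \<rho> x)" using D by (simp add: markov_kernel_def)
  also have "\<dots> = 1" using inv unfolding invariant_probability_def by blast
  finally show "(\<Sum>a\<le>\<kappa>. push \<kappa> \<rho> D a) = 1" .
next
  fix b assume b: "b \<le> \<kappa>"
  have inv': "\<rho> a = push \<kappa> \<rho> (kernel_mult \<kappa> D U) a" if "a \<le> \<kappa>" for a
    using inv that by (simp add: invariant_probability_def push_def)
  have "push \<kappa> \<rho> D b = push \<kappa> (push \<kappa> (push \<kappa> \<rho> D) U) D b"
    by (rule push_cong) (simp_all only: inv' push_push)
  also have "\<dots> = push \<kappa> (push \<kappa> \<rho> D) (kernel_mult \<kappa> U D) b" by (rule push_push)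
  also have "\<dots> = push \<kappa> (push \<kappa> \<rho> D) (kernel_mult \<kappa> D U) b"
    by (rule push_cong) (simp_all add: comm b)
  finally show "push \<kappa> \<rho> D b = (\<Sum>a\<le>\<kappa>. push \<kappa> \<rho> D a * kernel_mult \<kappa> D U a b)"
    by (simp add: push_def)
qed

section \<open>Sums over words and comparison of word probabilities\<close>

lemma sum_PiE_insert:
  assumes "x \<notin> S"
  shows "(\<Sum>a\<in>insert x S \<rightarrow>\<^sub>E B. f a) = (\<Sum>a\<in>S \<rightarrow>\<^sub>E B. \<Sum>c\<in>B. f (a(x := c)))"
proof -
  have "(\<Sum>a\<in>insert x S \<rightarrow>\<^sub>E B. f a) = (\<Sum>(c, a)\<in>B \<times> (S \<rightarrow>\<^sub>E B). f (a(x := c)))"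
    unfolding PiE_insert_eq
    by (subst sum.reindex[OF inj_combinator[OF assms]]) (simp add: case_prod_beta comp_def)
  also have "\<dots> = (\<Sum>c\<in>B. \<Sum>a\<in>S \<rightarrow>\<^sub>E B. f (a(x := c)))" by (rule sum.cartesian_product[symmetric])
  also have "\<dots> = (\<Sum>a\<in>S \<rightarrow>\<^sub>E B. \<Sum>c\<in>B. f (a(x := c)))" by (rule sum.swap)
  finally show ?thesis .
qed

lemma sum_words_0: "(\<Sum>a\<in>words \<kappa> 0. f a) = (\<Sum>c\<le>\<kappa>. f ((\<lambda>_. undefined)(0 := c)))"
  using sum_PiE_insert[where x = 0 and S = "{}" and B = "{..\<kappa>}" and f = f] by (simp add: fun_upd_def)

lemma sum_words_Suc:
  "(\<Sum>a\<in>words \<kappa> (Suc n). f a) = (\<Sum>a\<in>words \<kappa> n. \<Sum>c\<le>\<kappa>. f (a(Suc n := c)))"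
  unfolding atMost_Suc by (rule sum_PiE_insert) simp

definition hzmc_prob :: "(nat \<Rightarrow> real) \<Rightarrow> (nat \<Rightarrow> nat \<Rightarrow> real) \<Rightarrow> (nat \<Rightarrow> nat \<Rightarrow> real) \<Rightarrow>
    nat \<Rightarrow> (nat \<Rightarrow> nat) \<Rightarrow> (nat \<Rightarrow> nat) \<Rightarrow> real" where
  "hzmc_prob \<rho> D U n a b =
     \<rho> (a 0) * (\<Prod>i<n. D (a i) (b i) * U (b i) (a (Suc i))) * D (a n) (b n)"

text \<open>The product is regrouped around the summed letters: a_0 occurs only in \<rho>(a_0)
  D(a_0, b_0), and each later a_{i+1} only in U(b_i, a_{i+1}) D(a_{i+1}, b_{i+1}). Their sums are an
  entry of \<rho> D and entries of UD.\<close>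

lemma sum_hzmc_prob:
  "(\<Sum>a\<in>words \<kappa> n. hzmc_prob \<rho> D U n a b) =
     push \<kappa> \<rho> D (b 0) * (\<Prod>i<n. kernel_mult \<kappa> U D (b i) (b (Suc i)))"
proof (induction n)
  case 0
  then show ?case unfolding sum_words_0 by (simp add: hzmc_prob_def push_def)
next
  case (Suc n)
  have "hzmc_prob \<rho> D U (Suc n) (a(Suc n := c)) b = hzmc_prob \<rho> D U n a b * (U (b n) c * D c (b (Suc n)))"
    for a c
    by (simp add: hzmc_prob_def)
  then have "(\<Sum>a\<in>words \<kappa> (Suc n). hzmc_prob \<rho> D U (Suc n) a b) =
      (\<Sum>a\<in>words \<kappa> n. hzmc_prob \<rho> D U n a b) * kernel_mult \<kappa> U D (b n) (b (Suc n))"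
    unfolding sum_words_Suc by (simp add: kernel_mult_def sum_distrib_left[symmetric] sum_distrib_right[symmetric])
  then show ?case by (simp add: Suc.IH mult.assoc)
qed

text \<open>If the current line is a Markov chain with initial law \<open>\<sigma>\<close> and kernel \<open>K\<close>, this is the
  probability of the word \<open>a\<close> on it and \<open>b\<close> on the next one; \<open>c\<close> is the letter following \<open>a\<close>, on
  which the last letter of \<open>b\<close> depends.\<close>

definition image_prob :: "nat \<Rightarrow> (nat \<times> nat \<Rightarrow> nat \<Rightarrow> real) \<Rightarrow> (nat \<Rightarrow> real) \<Rightarrow>
    (nat \<Rightarrow> nat \<Rightarrow> real) \<Rightarrow> nat \<Rightarrow> (nat \<Rightarrow> nat) \<Rightarrow> (nat \<Rightarrow> nat) \<Rightarrow> real" where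
  "image_prob \<kappa> T \<sigma> K n a b =
     (\<Sum>c\<le>\<kappa>. \<sigma> (a 0) * (\<Prod>i<n. K (a i) (a (Suc i)) * T (a i, a (Suc i)) (b i)) *
        (K (a n) c * T (a n, c) (b n)))"

text \<open>The local identity replaces every factor, the boundary one becoming D(a_n, b_n) U(b_n,
  c); the sum over c is then a row sum of U.\<close>

lemma image_prob_eq_hzmc_prob:
  assumes U: "markov_kernel \<kappa> U"
    and T: "\<And>a b c. a \<le> \<kappa> \<Longrightarrow> b \<le> \<kappa> \<Longrightarrow> c \<le> \<kappa> \<Longrightarrow> K a b * T (a, b) c = D a c * U c b"
    and ab: "\<And>i. i \<le> n \<Longrightarrow> a i \<le> \<kappa> \<and> b i \<le> \<kappa>"
  shows "image_prob \<kappa> T \<rho> K n a b = hzmc_prob \<rho> D U n a b"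
proof -
  have "(\<Prod>i<n. K (a i) (a (Suc i)) * T (a i, a (Suc i)) (b i)) =
      (\<Prod>i<n. D (a i) (b i) * U (b i) (a (Suc i)))"
    by (rule prod.cong) (simp_all add: T ab)
  then have "image_prob \<kappa> T \<rho> K n a b =
      (\<Sum>c\<le>\<kappa>. \<rho> (a 0) * (\<Prod>i<n. D (a i) (b i) * U (b i) (a (Suc i))) * D (a n) (b n) * U (b n) c)"
    unfolding image_prob_def by (intro sum.cong) (simp_all add: T ab)
  also have "\<dots> = hzmc_prob \<rho> D U n a b * (\<Sum>c\<le>\<kappa>. U (b n) c)"
    by (simp only: hzmc_prob_def sum_distrib_left)
  also have "(\<Sum>c\<le>\<kappa>. U (b n) c) = 1" using U ab[of n] by (simp add: markov_kernel_def)
  finally show ?thesis by simp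
qed

text \<open>Lets an equality of values in \<open>ennreal\<close> be read back over the reals, where
  the embedding is injective only on nonnegative numbers.\<close>

lemma image_prob_nonneg:
  assumes "transition_matrix \<kappa> T"
    and "\<And>a. a \<le> \<kappa> \<Longrightarrow> 0 \<le> \<sigma> a" and "\<And>a b. a \<le> \<kappa> \<Longrightarrow> b \<le> \<kappa> \<Longrightarrow> 0 \<le> K a b"
    and "\<And>i. i \<le> n \<Longrightarrow> a i \<le> \<kappa> \<and> b i \<le> \<kappa>"
  shows "0 \<le> image_prob \<kappa> T \<sigma> K n a b"
  unfolding image_prob_def using assms
  by (intro sum_nonneg mult_nonneg_nonneg prod_nonneg) (auto simp: transition_matrix_def)

text \<open>Windows with n = 0 and n = 1 carry all the information. \<open>K\<close> and
  \<open>\<sigma>\<close> are left abstract: the argument rests on normalisation of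
  \<open>K\<close>, \<open>T\<close> and \<open>D\<close> and on positivity of
  \<open>\<rho>\<close>, and it recovers \<open>\<sigma>\<close> and \<open>K\<close> from the
  equations.\<close>

lemma
  assumes T: "transition_matrix \<kappa> T" and D: "markov_kernel \<kappa> D" and U: "markov_kernel \<kappa> U"
    and K: "\<And>a. a \<le> \<kappa> \<Longrightarrow> (\<Sum>b\<le>\<kappa>. K a b) = 1"
    and \<rho>: "\<And>a. a \<le> \<kappa> \<Longrightarrow> 0 < \<rho> a"
    and eq: "\<And>n a b. (\<And>i. i \<le> n \<Longrightarrow> a i \<le> \<kappa> \<and> b i \<le> \<kappa>) \<Longrightarrow>
      hzmc_prob \<rho> D U n a b = image_prob \<kappa> T \<sigma> K n a b"
    and x: "x \<le> \<kappa>" and w: "w \<le> \<kappa>"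
  shows transition_eq_of_image_prob_eq: "y \<le> \<kappa> \<Longrightarrow> K x w * T (x, w) y = D x y * U y w"
    and kernel_eq_of_image_prob_eq: "K x w = kernel_mult \<kappa> D U x w"
proof -
  have sum_D: "(\<Sum>y\<le>\<kappa>. D v y) = 1" if "v \<le> \<kappa>" for v using D that by (simp add: markov_kernel_def)
  have sum_T: "(\<Sum>y\<le>\<kappa>. T (u, v) y) = 1" if "u \<le> \<kappa>" "v \<le> \<kappa>" for u v
    using T that by (simp add: transition_matrix_def)
  \<comment> \<open>Total mass of the joint law of the right neighbour c and the new letter y, given
    the current letter v.\<close>
  have sum_KT: "(\<Sum>y\<le>\<kappa>. \<Sum>c\<le>\<kappa>. K v c * T (v, c) y) = 1" if "v \<le> \<kappa>" for v
  proof -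
    have "(\<Sum>y\<le>\<kappa>. \<Sum>c\<le>\<kappa>. K v c * T (v, c) y) = (\<Sum>c\<le>\<kappa>. K v c * (\<Sum>y\<le>\<kappa>. T (v, c) y))"
      unfolding sum_distrib_left by (rule sum.swap)
    then show ?thesis using that by (simp add: sum_T K)
  qed
  have "\<rho> x * D x y = \<sigma> x * (\<Sum>c\<le>\<kappa>. K x c * T (x, c) y)" if "y \<le> \<kappa>" for y
    using eq[of 0 "\<lambda>_. x" "\<lambda>_. y"] x that by (simp add: hzmc_prob_def image_prob_def sum_distrib_left)
  then have "(\<Sum>y\<le>\<kappa>. \<rho> x * D x y) = (\<Sum>y\<le>\<kappa>. \<sigma> x * (\<Sum>c\<le>\<kappa>. K x c * T (x, c) y))"
    by (intro sum.cong) auto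
  then have \<sigma>: "\<rho> x = \<sigma> x"
    unfolding sum_distrib_left[symmetric] using x by (simp add: sum_D sum_KT)
  show main: "K x w * T (x, w) y = D x y * U y w" if y: "y \<le> \<kappa>" for y
  proof -
    \<comment> \<open>The window n = 1 with the words a = x w and b = y z. Summing over z reduces
      the last factor on each side to 1.\<close>
    have "\<rho> x * (D x y * U y w) * D w z = \<sigma> x * (K x w * T (x, w) y) * (\<Sum>c\<le>\<kappa>. K w c * T (w, c) z)"
      if "z \<le> \<kappa>" for z
      using eq[of 1 "(\<lambda>_. w)(0 := x)" "(\<lambda>_. z)(0 := y)"] x w y that
      by (simp add: hzmc_prob_def image_prob_def sum_distrib_left)
    then have "(\<Sum>z\<le>\<kappa>. \<rho> x * (D x y * U y w) * D w z) =
        (\<Sum>z\<le>\<kappa>. \<sigma> x * (K x w * T (x, w) y) * (\<Sum>c\<le>\<kappa>. K w c * T (w, c) z))"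
      by (intro sum.cong) auto
    then show ?thesis
      unfolding sum_distrib_left[symmetric] using \<rho>[OF x] w by (simp add: sum_D sum_KT \<sigma>)
  qed
  have "K x w * (\<Sum>y\<le>\<kappa>. T (x, w) y) = kernel_mult \<kappa> D U x w"
    unfolding kernel_mult_def sum_distrib_left by (rule sum.cong) (simp_all add: main)
  then show "K x w = kernel_mult \<kappa> D U x w" using x w by (simp add: sum_T)
qed

subsection \<open>The action of the automaton\<close>

lemma prob_space_point_measure_transition:
  assumes "transition_matrix \<kappa> T" "a \<le> \<kappa>" "b \<le> \<kappa>"
  shows "prob_space (point_measure {..\<kappa>} (\<lambda>c. ennreal (T (a, b) c)))"
proof (rule prob_spaceI)
  have "(\<Sum>c\<le>\<kappa>. ennreal (T (a, b) c)) = ennreal (\<Sum>c\<le>\<kappa>. T (a, b) c)"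
    by (rule sum_ennreal) (use assms in \<open>simp add: transition_matrix_def\<close>)
  then show "emeasure (point_measure {..\<kappa>} (\<lambda>c. ennreal (T (a, b) c)))
      (space (point_measure {..\<kappa>} (\<lambda>c. ennreal (T (a, b) c)))) = 1"
    using assms by (simp add: emeasure_point_measure_finite space_point_measure transition_matrix_def)
qed

lemma sets_pca_step: "sets (pca_step \<kappa> T s) = sets (line_space \<kappa>)"
  unfolding pca_step_def line_space_def
  by (rule sets_PiM_cong[OF refl]) (rule sets_point_measure_count_space)

lemma prob_space_pca_step:
  "transition_matrix \<kappa> T \<Longrightarrow> s \<in> space (line_space \<kappa>) \<Longrightarrow> prob_space (pca_step \<kappa> T s)"
  unfolding pca_step_def
  by (intro prob_space_PiM prob_space_point_measure_transition) (simp_all add: space_line)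

text \<open>Independence of the new letters, stated for boxes over \<open>count_space\<close>
  because these generate \<open>line_space\<close>; the point measures have the same underlying
  spaces, so the boxes coincide.\<close>

lemma emeasure_pca_step:
  assumes "transition_matrix \<kappa> T" "s \<in> space (line_space \<kappa>)" "finite J" "\<And>x. x \<in> J \<Longrightarrow> A x \<subseteq> {..\<kappa>}"
  shows "emeasure (pca_step \<kappa> T s) (prod_emb UNIV (\<lambda>_. count_space {..\<kappa>}) J (Pi\<^sub>E J A)) =
    (\<Prod>x\<in>J. \<Sum>c\<in>A x. ennreal (T (s x, s (x + 1)) c))"
proof -
  let ?M = "\<lambda>x. point_measure {..\<kappa>} (\<lambda>c. ennreal (T (s x, s (x + 1)) c))"
  have "prod_emb UNIV (\<lambda>_. count_space {..\<kappa>}) J (Pi\<^sub>E J A) = prod_emb UNIV ?M J (Pi\<^sub>E J A)"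
    by (simp add: prod_emb_def space_point_measure)
  moreover have "emeasure (PiM UNIV ?M) (prod_emb UNIV ?M J (Pi\<^sub>E J A)) = (\<Prod>x\<in>J. emeasure (?M x) (A x))"
    by (rule emeasure_PiM_emb)
      (use assms in \<open>auto simp: sets_point_measure space_line intro!: prob_space_point_measure_transition\<close>)
  moreover have "emeasure (?M x) (A x) = (\<Sum>c\<in>A x. ennreal (T (s x, s (x + 1)) c))" if "x \<in> J" for x
    by (rule emeasure_point_measure_finite) (use assms(4)[OF that] in auto)
  ultimately show ?thesis by (simp add: pca_step_def)
qed

text \<open>It suffices to test boxes, whose probability is a finite product of finite sums of
  entries of \<open>T\<close>, each depending on two coordinates of the current line.\<close>

lemma measurable_pca_step:
  assumes T: "transition_matrix \<kappa> T"
  shows "pca_step \<kappa> T \<in> line_space \<kappa> \<rightarrow>\<^sub>M subprob_algebra (line_space \<kappa>)"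
proof (rule measurable_subprob_algebra_generated)
  let ?L = "line_space \<kappa>"
  show "sets ?L = sigma_sets (\<Pi>\<^sub>E x\<in>UNIV. space (count_space {..\<kappa>})) (prod_algebra UNIV (\<lambda>_. count_space {..\<kappa>}))"
    unfolding line_space_def by (rule sets_PiM)
  show "prod_algebra UNIV (\<lambda>_::int. count_space {..\<kappa>}) \<subseteq> Pow (\<Pi>\<^sub>E x\<in>UNIV. space (count_space {..\<kappa>}))"
    by (rule prod_algebra_sets_into_space)
  show "subprob_space (pca_step \<kappa> T s)" if "s \<in> space ?L" for s
    using prob_space_pca_step[OF T that] by (rule prob_space_imp_subprob_space)
  have "(\<Pi>\<^sub>E x\<in>UNIV. space (count_space {..\<kappa>})) = space ?L"
    unfolding line_space_def space_PiM ..
  moreover have "emeasure (pca_step \<kappa> T s) (space ?L) = 1" if "s \<in> space ?L" for s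
    using prob_space.emeasure_space_1[OF prob_space_pca_step[OF T that]]
    unfolding sets_eq_imp_space_eq[OF sets_pca_step] .
  ultimately show "(\<lambda>s. emeasure (pca_step \<kappa> T s) (\<Pi>\<^sub>E x\<in>UNIV. space (count_space {..\<kappa>}))) \<in> borel_measurable ?L"
    by (simp cong: measurable_cong)
  fix A assume "A \<in> prod_algebra UNIV (\<lambda>_::int. count_space {..\<kappa>})"
  then obtain J E where A: "A = prod_emb UNIV (\<lambda>_. count_space {..\<kappa>}) J (Pi\<^sub>E J E)"
    and J: "finite J" and E: "\<And>x. x \<in> J \<Longrightarrow> E x \<in> sets (count_space {..\<kappa>})"
    by (rule prod_algebraE) (rule that)
  \<comment> \<open>On a countable set of pairs the product sigma-algebra is discrete, so any
    function of the pair is measurable, whatever \<open>T\<close> is.\<close>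
  have pair: "(\<lambda>s. (s x, s (x + 1))) \<in> ?L \<rightarrow>\<^sub>M count_space UNIV" for x
    using measurable_Pair[OF line_component_UNIV[of x \<kappa>] line_component_UNIV[of "x + 1" \<kappa>]]
    by (simp add: pair_measure_countable)
  have "(\<lambda>s. ennreal (T (s x, s (x + 1)) c)) \<in> borel_measurable ?L" for x c
    by (rule measurable_compose[OF pair[of x], of "\<lambda>p. ennreal (T p c)"]) simp
  then have "(\<lambda>s. \<Prod>x\<in>J. \<Sum>c\<in>E x. ennreal (T (s x, s (x + 1)) c)) \<in> borel_measurable ?L"
    by (intro borel_measurable_prod_ennreal borel_measurable_sum)
  moreover have "emeasure (pca_step \<kappa> T s) A = (\<Prod>x\<in>J. \<Sum>c\<in>E x. ennreal (T (s x, s (x + 1)) c))"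
    if "s \<in> space ?L" for s
    unfolding A using E by (intro emeasure_pca_step[OF T that J]) simp
  ultimately show "(\<lambda>s. emeasure (pca_step \<kappa> T s) A) \<in> borel_measurable ?L"
    by (subst measurable_cong)
qed (rule Int_stable_prod_algebra sets_pca_step)+

lemma emeasure_pca_step_window:
  assumes T: "transition_matrix \<kappa> T" and s: "s \<in> space (line_space \<kappa>)" and b: "\<And>i. i \<le> n \<Longrightarrow> b i \<le> \<kappa>"
  shows "emeasure (pca_step \<kappa> T s) {s' \<in> space (line_space \<kappa>). \<forall>i\<le>n. s' (i0 + int i) = b i} =
    (\<Prod>i\<le>n. ennreal (T (s (i0 + int i), s (i0 + int (Suc i))) (b i)))"
proof -
  let ?J = "(\<lambda>i. i0 + int i) ` {..n}"
  \<comment> \<open>Boxes are indexed by positions; \<open>nat (x - i0)\<close> recovers the index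
    in the word from the position \<open>x\<close>.\<close>
  have "{s' \<in> space (line_space \<kappa>). \<forall>i\<le>n. s' (i0 + int i) = b i} =
      prod_emb UNIV (\<lambda>_. count_space {..\<kappa>}) ?J (\<Pi>\<^sub>E x\<in>?J. {b (nat (x - i0))})"
    by (auto simp: prod_emb_def space_line PiE_iff)
  then have "emeasure (pca_step \<kappa> T s) {s' \<in> space (line_space \<kappa>). \<forall>i\<le>n. s' (i0 + int i) = b i} =
      (\<Prod>x\<in>?J. \<Sum>c\<in>{b (nat (x - i0))}. ennreal (T (s x, s (x + 1)) c))"
    using b by (simp only:) (intro emeasure_pca_step[OF T s]; auto)
  also have "\<dots> = (\<Prod>i\<le>n. ennreal (T (s (i0 + int i), s (i0 + int (Suc i))) (b i)))"
    by (subst prod.reindex) (auto simp: inj_on_def add.assoc add.commute[of 1])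
  finally show ?thesis .
qed

section \<open>One step on the zigzag\<close>

lemma measurable_zigzag_step:
  assumes "transition_matrix \<kappa> T"
  shows "(\<lambda>\<omega>. distr (pca_step \<kappa> T (snd \<omega>)) (zigzag_space \<kappa>) (\<lambda>s2. (snd \<omega>, s2)))
    \<in> zigzag_space \<kappa> \<rightarrow>\<^sub>M subprob_algebra (zigzag_space \<kappa>)"
proof (rule measurable_distr2[where M = "line_space \<kappa>"])
  have "(\<lambda>p. (snd (fst p), snd p)) \<in> zigzag_space \<kappa> \<Otimes>\<^sub>M line_space \<kappa> \<rightarrow>\<^sub>M line_space \<kappa> \<Otimes>\<^sub>M line_space \<kappa>"
    by (rule measurable_Pair[OF measurable_compose[OF measurable_fst zigzag_snd] measurable_snd])
  then show "(\<lambda>(\<omega>, s2). (snd \<omega>, s2)) \<in> zigzag_space \<kappa> \<Otimes>\<^sub>M line_space \<kappa> \<rightarrow>\<^sub>M zigzag_space \<kappa>"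
    by (simp add: case_prod_beta' zigzag_space_def)
  show "(\<lambda>\<omega>. pca_step \<kappa> T (snd \<omega>)) \<in> zigzag_space \<kappa> \<rightarrow>\<^sub>M subprob_algebra (line_space \<kappa>)"
    by (rule measurable_compose[OF zigzag_snd measurable_pca_step[OF assms]])
qed

text \<open>The n + 1 new letters depend on n + 2 letters of the current line, and the cylinder
  leaves the last of these free. Splitting over its value c writes the kernel as a finite
  combination of indicators of second-line words, which can be integrated term by term.\<close>

lemma emeasure_zigzag_step:
  assumes T: "transition_matrix \<kappa> T" and \<omega>: "\<omega> \<in> space (zigzag_space \<kappa>)"
    and b: "\<And>i. i \<le> n \<Longrightarrow> b i \<le> \<kappa>"
  shows "emeasure (distr (pca_step \<kappa> T (snd \<omega>)) (zigzag_space \<kappa>) (\<lambda>s2. (snd \<omega>, s2))) (cylinder \<kappa> i0 n a b) =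
    (\<Sum>c\<le>\<kappa>. (\<Prod>i\<le>n. ennreal (T ((a(Suc n := c)) i, (a(Suc n := c)) (Suc i)) (b i))) *
      indicator {\<omega> \<in> space (zigzag_space \<kappa>). \<forall>i\<le>Suc n. snd \<omega> (i0 + int i) = (a(Suc n := c)) i} \<omega>)"
    (is "?L = (\<Sum>c\<le>\<kappa>. ?P c * indicator (?S c) \<omega>)")
proof -
  have s: "snd \<omega> \<in> space (line_space \<kappa>)" using \<omega> by (simp add: space_zigzag space_line)
  \<comment> \<open>The actual letter to the right of the window, the only c whose indicator can be
    nonzero.\<close>
  let ?c = "snd \<omega> (i0 + int (Suc n))"
  let ?F = "{s' \<in> space (line_space \<kappa>). \<forall>i\<le>n. s' (i0 + int i) = b i}"
  have sp: "space (pca_step \<kappa> T (snd \<omega>)) = space (line_space \<kappa>)"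
    by (rule sets_eq_imp_space_eq[OF sets_pca_step])
  have "(\<lambda>s2. (snd \<omega>, s2)) \<in> pca_step \<kappa> T (snd \<omega>) \<rightarrow>\<^sub>M zigzag_space \<kappa>"
    unfolding measurable_cong_sets[OF sets_pca_step refl] zigzag_space_def
    using s by (rule measurable_Pair1')
  then have L: "?L = emeasure (pca_step \<kappa> T (snd \<omega>)) ((\<lambda>s2. (snd \<omega>, s2)) -` cylinder \<kappa> i0 n a b \<inter> space (line_space \<kappa>))"
    unfolding sp[symmetric] using cylinder_sets by (rule emeasure_distr)
  have S: "indicator (?S c) \<omega> = (if c = ?c \<and> (\<forall>i\<le>n. snd \<omega> (i0 + int i) = a i) then 1 else (0::ennreal))" for c
    using \<omega> by (auto simp: indicator_def le_Suc_eq)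
  show ?thesis
  proof (cases "\<forall>i\<le>n. snd \<omega> (i0 + int i) = a i")
    case True
    have "(\<lambda>s2. (snd \<omega>, s2)) -` cylinder \<kappa> i0 n a b \<inter> space (line_space \<kappa>) = ?F"
      using True s by (auto simp: cylinder_def space_line space_zigzag)
    then have "?L = (\<Prod>i\<le>n. ennreal (T (snd \<omega> (i0 + int i), snd \<omega> (i0 + int (Suc i))) (b i)))"
      unfolding L by (simp only:) (rule emeasure_pca_step_window[OF T s b])
    \<comment> \<open>At i = n the right neighbour is the appended letter \<open>?c\<close>; for
      smaller i it still lies in the window and equals \<open>a (Suc i)\<close>.\<close>
    also have "\<dots> = ?P ?c"
    proof (rule prod.cong[OF refl])
      fix i assume "i \<in> {..n}"
      then show "ennreal (T (snd \<omega> (i0 + int i), snd \<omega> (i0 + int (Suc i))) (b i)) =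
        ennreal (T ((a(Suc n := ?c)) i, (a(Suc n := ?c)) (Suc i)) (b i))"
        using True True[THEN spec, of "Suc i"] by (cases "i = n") auto
    qed
    also have "\<dots> = (\<Sum>c\<le>\<kappa>. ?P c * indicator (?S c) \<omega>)"
      unfolding S using True s by (simp add: space_line if_distrib[of "(*) _"] sum.delta cong: if_cong)
    finally show ?thesis .
  next
    case False
    then have "(\<lambda>s2. (snd \<omega>, s2)) -` cylinder \<kappa> i0 n a b \<inter> space (line_space \<kappa>) = {}"
      by (auto simp: cylinder_def)
    then show ?thesis unfolding L S using False by (simp only: emeasure_empty) simp
  qed
qed

lemma snd_window_sets:
  "{\<omega> \<in> space (zigzag_space \<kappa>). \<forall>i\<le>n. snd \<omega> (i0 + int i) = b i} \<in> sets (zigzag_space \<kappa>)"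
proof -
  have "{\<omega> \<in> space (zigzag_space \<kappa>). \<forall>i\<in>{..n}. snd \<omega> (i0 + int i) = b i} \<in> sets (zigzag_space \<kappa>)"
    by (rule sets.sets_Collect_finite_All) (rule zigzag_component_sets, rule finite_atMost)
  then show ?thesis by (simp only: Ball_def atMost_iff)
qed

lemma
  assumes T: "transition_matrix \<kappa> T" and m: "sets m = sets (zigzag_space \<kappa>)"
  shows sets_pca_zigzag: "sets (pca_zigzag \<kappa> T m) = sets (zigzag_space \<kappa>)"
    and emeasure_pca_zigzag: "(\<And>i. i \<le> n \<Longrightarrow> b i \<le> \<kappa>) \<Longrightarrow>
      emeasure (pca_zigzag \<kappa> T m) (cylinder \<kappa> i0 n a b) =
      (\<Sum>c\<le>\<kappa>. (\<Prod>i\<le>n. ennreal (T ((a(Suc n := c)) i, (a(Suc n := c)) (Suc i)) (b i))) *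
        emeasure m {\<omega> \<in> space (zigzag_space \<kappa>). \<forall>i\<le>Suc n. snd \<omega> (i0 + int i) = (a(Suc n := c)) i})"
proof -
  define F where "F = (\<lambda>\<omega> :: (int \<Rightarrow> nat) \<times> (int \<Rightarrow> nat). distr (pca_step \<kappa> T (snd \<omega>)) (zigzag_space \<kappa>) (\<lambda>s2. (snd \<omega>, s2)))"
  have sp: "space m = space (zigzag_space \<kappa>)" using m by (rule sets_eq_imp_space_eq)
  \<comment> \<open>A witness that the space is nonempty, as the rules for \<open>bind\<close>
    require.\<close>
  have "(\<lambda>_. 0, \<lambda>_. 0) \<in> space m" by (simp add: sp space_zigzag)
  then have ne: "space m \<noteq> {}" by blast
  have F: "F \<in> m \<rightarrow>\<^sub>M subprob_algebra (zigzag_space \<kappa>)"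
    unfolding measurable_cong_sets[OF m refl] F_def by (rule measurable_zigzag_step[OF T])
  have eq: "pca_zigzag \<kappa> T m = m \<bind> F"
    by (simp add: pca_zigzag_def F_def case_prod_beta')
  show "sets (pca_zigzag \<kappa> T m) = sets (zigzag_space \<kappa>)"
    unfolding eq using F ne by (rule sets_bind_measurable)
  let ?S = "\<lambda>c. {\<omega> \<in> space (zigzag_space \<kappa>). \<forall>i\<le>Suc n. snd \<omega> (i0 + int i) = (a(Suc n := c)) i}"
  let ?P = "\<lambda>c. \<Prod>i\<le>n. ennreal (T ((a(Suc n := c)) i, (a(Suc n := c)) (Suc i)) (b i))"
  have S: "?S c \<in> sets m" for c unfolding m by (rule snd_window_sets)
  assume b: "\<And>i. i \<le> n \<Longrightarrow> b i \<le> \<kappa>"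
  have "emeasure (pca_zigzag \<kappa> T m) (cylinder \<kappa> i0 n a b) = (\<integral>\<^sup>+ \<omega>. emeasure (F \<omega>) (cylinder \<kappa> i0 n a b) \<partial>m)"
    unfolding eq by (rule emeasure_bind[OF ne F cylinder_sets])
  also have "\<dots> = (\<integral>\<^sup>+ \<omega>. (\<Sum>c\<le>\<kappa>. ?P c * indicator (?S c) \<omega>) \<partial>m)"
  proof (rule nn_integral_cong)
    fix \<omega> assume "\<omega> \<in> space m"
    then have "\<omega> \<in> space (zigzag_space \<kappa>)" unfolding sp .
    then show "emeasure (F \<omega>) (cylinder \<kappa> i0 n a b) = (\<Sum>c\<le>\<kappa>. ?P c * indicator (?S c) \<omega>)"
      unfolding F_def using b by (rule emeasure_zigzag_step[OF T])
  qed
  also have "\<dots> = (\<Sum>c\<le>\<kappa>. \<integral>\<^sup>+ \<omega>. ?P c * indicator (?S c) \<omega> \<partial>m)"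
    by (rule nn_integral_sum)
      (rule borel_measurable_times_ennreal[OF borel_measurable_const borel_measurable_indicator[OF S]])
  also have "\<dots> = (\<Sum>c\<le>\<kappa>. ?P c * emeasure m (?S c))"
    by (rule sum.cong[OF refl nn_integral_cmult_indicator[OF S]])
  finally show "emeasure (pca_zigzag \<kappa> T m) (cylinder \<kappa> i0 n a b) = (\<Sum>c\<le>\<kappa>. ?P c * emeasure m (?S c))" .
qed

subsection \<open>Invariance\<close>

text \<open>The nonnegativity of \<open>hzmc_prob\<close> is read off from the law: the product is
  the probability of a cylinder.\<close>

lemma hzmc_lawD:
  assumes "hzmc_law \<kappa> \<rho> D U m"
  shows "prob_space m" "sets m = sets (zigzag_space \<kappa>)"
    and "(\<And>i. i \<le> n \<Longrightarrow> a i \<le> \<kappa> \<and> b i \<le> \<kappa>) \<Longrightarrow>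
      emeasure m (cylinder \<kappa> i0 n a b) = ennreal (hzmc_prob \<rho> D U n a b)"
    and "(\<And>i. i \<le> n \<Longrightarrow> a i \<le> \<kappa> \<and> b i \<le> \<kappa>) \<Longrightarrow> 0 \<le> hzmc_prob \<rho> D U n a b"
proof -
  show m: "prob_space m" "sets m = sets (zigzag_space \<kappa>)"
    using assms unfolding hzmc_law_def by blast+
  interpret prob_space m by fact
  have sp: "space m = space (zigzag_space \<kappa>)" using m(2) by (rule sets_eq_imp_space_eq)
  assume ab: "\<And>i. i \<le> n \<Longrightarrow> a i \<le> \<kappa> \<and> b i \<le> \<kappa>"
  have "measure m (cylinder \<kappa> j n a b) = hzmc_prob \<rho> D U n a b" for j
    using assms ab unfolding hzmc_law_def cylinder_def hzmc_prob_def sp by (simp add: case_prod_beta')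
  then show "emeasure m (cylinder \<kappa> i0 n a b) = ennreal (hzmc_prob \<rho> D U n a b)"
    and "0 \<le> hzmc_prob \<rho> D U n a b"
    by (metis emeasure_eq_measure, metis measure_nonneg)
qed

text \<open>Splitting over the word on the first line gives disjoint cylinders, and
  \<open>sum_hzmc_prob\<close> evaluates the sum of their probabilities.\<close>

lemma hzmc_law_snd:
  assumes law: "hzmc_law \<kappa> \<rho> D U m" and b: "\<And>i. i \<le> n \<Longrightarrow> b i \<le> \<kappa>"
  shows "emeasure m {\<omega> \<in> space (zigzag_space \<kappa>). \<forall>i\<le>n. snd \<omega> (i0 + int i) = b i} =
    ennreal (push \<kappa> \<rho> D (b 0) * (\<Prod>i<n. kernel_mult \<kappa> U D (b i) (b (Suc i))))"
    (is "emeasure m {\<omega> \<in> space ?Z. ?P \<omega>} = _")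
proof -
  note m = hzmc_lawD(2)[OF law]
  have sp: "space m = space ?Z" using m by (rule sets_eq_imp_space_eq)
  have cyl: "{\<omega> \<in> space m. window i0 n (fst \<omega>) = a \<and> ?P \<omega>} = cylinder \<kappa> i0 n a b" if "a \<in> words \<kappa> n" for a
    unfolding window_eq_iff[OF that] by (auto simp: cylinder_def sp)
  have "emeasure m {\<omega> \<in> space m. ?P \<omega>} =
      (\<Sum>a\<in>words \<kappa> n. emeasure m {\<omega> \<in> space m. window i0 n (fst \<omega>) = a \<and> ?P \<omega>})"
  proof (rule emeasure_split_finite(2)[OF finite_words])
    show "window i0 n (fst \<omega>) \<in> words \<kappa> n" if "\<omega> \<in> space m" for \<omega>
      using that by (intro window_in_words) (simp add: sp space_zigzag)
    show "{\<omega> \<in> space m. window i0 n (fst \<omega>) = a \<and> ?P \<omega>} \<in> sets m" if "a \<in> words \<kappa> n" for a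
      unfolding cyl[OF that] m by (rule cylinder_sets)
  qed
  also have "\<dots> = (\<Sum>a\<in>words \<kappa> n. emeasure m (cylinder \<kappa> i0 n a b))"
    by (intro sum.cong refl arg_cong[of _ _ "emeasure m"] cyl)
  also have "\<dots> = (\<Sum>a\<in>words \<kappa> n. ennreal (hzmc_prob \<rho> D U n a b))"
    by (intro sum.cong refl hzmc_lawD(3)[OF law]) (use b in auto)
  also have "\<dots> = ennreal (\<Sum>a\<in>words \<kappa> n. hzmc_prob \<rho> D U n a b)"
    by (intro sum_ennreal hzmc_lawD(4)[OF law]) (use b in auto)
  finally show ?thesis unfolding sum_hzmc_prob sp .
qed

lemma pca_zigzag_hzmc:
  assumes law: "hzmc_law \<kappa> \<rho> D U m" and T: "transition_matrix \<kappa> T"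
    and D: "markov_kernel \<kappa> D" and U: "markov_kernel \<kappa> U"
    and \<rho>: "invariant_probability \<kappa> (kernel_mult \<kappa> D U) \<rho>"
    and ab: "\<And>i. i \<le> n \<Longrightarrow> a i \<le> \<kappa> \<and> b i \<le> \<kappa>"
  shows "emeasure (pca_zigzag \<kappa> T m) (cylinder \<kappa> i0 n a b) =
    ennreal (image_prob \<kappa> T (push \<kappa> \<rho> D) (kernel_mult \<kappa> U D) n a b)"
proof -
  let ?K = "kernel_mult \<kappa> U D" and ?\<sigma> = "push \<kappa> \<rho> D"
  let ?R = "\<lambda>c. (\<Prod>i\<le>n. T ((a(Suc n := c)) i, (a(Suc n := c)) (Suc i)) (b i)) *
    (?\<sigma> ((a(Suc n := c)) 0) * (\<Prod>i<Suc n. ?K ((a(Suc n := c)) i) ((a(Suc n := c)) (Suc i))))"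
  have a': "(a(Suc n := c)) i \<le> \<kappa>" if "i \<le> Suc n" "c \<le> \<kappa>" for i c
    using ab[of i] that by (auto simp: le_Suc_eq)
  have T0: "0 \<le> T (x, y) z" if "x \<le> \<kappa>" "y \<le> \<kappa>" "z \<le> \<kappa>" for x y z
    using T that by (simp add: transition_matrix_def)
  \<comment> \<open>The updated word agrees with \<open>a\<close> up to n, so the update survives
    only in the factor i = n of the two products, which splits off as the boundary term with
    c.\<close>
  have R: "?R c = ?\<sigma> (a 0) * (\<Prod>i<n. ?K (a i) (a (Suc i)) * T (a i, a (Suc i)) (b i)) *
        (?K (a n) c * T (a n, c) (b n))" for c
    by (simp add: prod.distrib lessThan_Suc_atMost[symmetric] mult_ac)
  have R0: "0 \<le> ?R c" if "c \<le> \<kappa>" for c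
    by (intro mult_nonneg_nonneg prod_nonneg T0 push_nonneg[OF \<rho> D] ballI kernel_mult_nonneg[OF U D] a' that)
      (use ab in auto)
  have "emeasure (pca_zigzag \<kappa> T m) (cylinder \<kappa> i0 n a b) =
      (\<Sum>c\<le>\<kappa>. (\<Prod>i\<le>n. ennreal (T ((a(Suc n := c)) i, (a(Suc n := c)) (Suc i)) (b i))) *
        emeasure m {\<omega> \<in> space (zigzag_space \<kappa>). \<forall>i\<le>Suc n. snd \<omega> (i0 + int i) = (a(Suc n := c)) i})"
    by (rule emeasure_pca_zigzag[OF T hzmc_lawD(2)[OF law]]) (use ab in blast)
  also have "\<dots> = (\<Sum>c\<le>\<kappa>. ennreal (?R c))"
  proof (rule sum.cong[OF refl])
    fix c assume "c \<in> {..\<kappa>}"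
    then have c: "c \<le> \<kappa>" by simp
    have P: "(\<Prod>i\<le>n. ennreal (T ((a(Suc n := c)) i, (a(Suc n := c)) (Suc i)) (b i))) =
        ennreal (\<Prod>i\<le>n. T ((a(Suc n := c)) i, (a(Suc n := c)) (Suc i)) (b i))"
      by (rule prod_ennreal) (rule T0; use c a' ab in auto)
    have P0: "0 \<le> (\<Prod>i\<le>n. T ((a(Suc n := c)) i, (a(Suc n := c)) (Suc i)) (b i))"
      by (rule prod_nonneg) (rule T0; use c a' ab in auto)
    have E: "emeasure m {\<omega> \<in> space (zigzag_space \<kappa>). \<forall>i\<le>Suc n. snd \<omega> (i0 + int i) = (a(Suc n := c)) i} =
        ennreal (?\<sigma> ((a(Suc n := c)) 0) *
          (\<Prod>i<Suc n. ?K ((a(Suc n := c)) i) ((a(Suc n := c)) (Suc i))))"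
      by (rule hzmc_law_snd[OF law]) (rule a'[OF _ c])
    show "(\<Prod>i\<le>n. ennreal (T ((a(Suc n := c)) i, (a(Suc n := c)) (Suc i)) (b i))) *
        emeasure m {\<omega> \<in> space (zigzag_space \<kappa>). \<forall>i\<le>Suc n. snd \<omega> (i0 + int i) = (a(Suc n := c)) i} =
      ennreal (?R c)"
      unfolding P E by (rule ennreal_mult'[OF P0, symmetric])
  qed
  also have "\<dots> = ennreal (\<Sum>c\<le>\<kappa>. ?R c)"
    by (rule sum_ennreal) (use R0 in simp)
  finally show ?thesis unfolding R image_prob_def .
qed

text \<open>Both word probabilities are independent of the starting position. Cylinders starting at
  0 therefore yield all the equations, and these in turn give equality on cylinders starting
  anywhere.\<close>

lemma pca_zigzag_eq_iff:
  assumes law: "hzmc_law \<kappa> \<rho> D U m" and T: "transition_matrix \<kappa> T"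
    and D: "markov_kernel \<kappa> D" and U: "markov_kernel \<kappa> U"
    and \<rho>: "invariant_probability \<kappa> (kernel_mult \<kappa> D U) \<rho>"
  shows "pca_zigzag \<kappa> T m = m \<longleftrightarrow> (\<forall>n a b. (\<forall>i\<le>n. a i \<le> \<kappa> \<and> b i \<le> \<kappa>) \<longrightarrow>
    hzmc_prob \<rho> D U n a b = image_prob \<kappa> T (push \<kappa> \<rho> D) (kernel_mult \<kappa> U D) n a b)"
    (is "_ \<longleftrightarrow> ?R")
proof
  assume eq: "pca_zigzag \<kappa> T m = m"
  show ?R
  proof (intro allI impI)
    fix n and a b :: "nat \<Rightarrow> nat" assume "\<forall>i\<le>n. a i \<le> \<kappa> \<and> b i \<le> \<kappa>"
    then have ab: "a i \<le> \<kappa> \<and> b i \<le> \<kappa>" if "i \<le> n" for i using that by simp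
    let ?h = "hzmc_prob \<rho> D U n a b"
      and ?q = "image_prob \<kappa> T (push \<kappa> \<rho> D) (kernel_mult \<kappa> U D) n a b"
    have "emeasure m (cylinder \<kappa> 0 n a b) = ennreal ?h"
      using ab by (rule hzmc_lawD(3)[OF law])
    moreover have "emeasure m (cylinder \<kappa> 0 n a b) = ennreal ?q"
      using pca_zigzag_hzmc[OF law T D U \<rho>, of n a b 0] ab unfolding eq by blast
    moreover have "0 \<le> ?h" using ab by (rule hzmc_lawD(4)[OF law])
    moreover have "0 \<le> ?q"
      by (rule image_prob_nonneg[OF T]) (erule push_nonneg[OF \<rho> D] kernel_mult_nonneg[OF U D] ab | assumption)+
    ultimately show "?h = ?q" by (metis ennreal_inj)
  qed
next
  assume eq: ?R
  show "pca_zigzag \<kappa> T m = m"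
  proof (rule zigzag_measure_eqI[symmetric])
    show "finite_measure m" using hzmc_lawD(1)[OF law] by (rule prob_space.finite_measure)
    show "sets m = sets (zigzag_space \<kappa>)" by (rule hzmc_lawD(2)[OF law])
    then show "sets (pca_zigzag \<kappa> T m) = sets (zigzag_space \<kappa>)" by (rule sets_pca_zigzag[OF T])
    fix i0 n and a b :: "nat \<Rightarrow> nat" assume ab: "\<And>i. i \<le> n \<Longrightarrow> a i \<le> \<kappa> \<and> b i \<le> \<kappa>"
    show "emeasure m (cylinder \<kappa> i0 n a b) = emeasure (pca_zigzag \<kappa> T m) (cylinder \<kappa> i0 n a b)"
    proof -
      have "emeasure m (cylinder \<kappa> i0 n a b) = ennreal (hzmc_prob \<rho> D U n a b)"
        using ab by (rule hzmc_lawD(3)[OF law])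
      also have "hzmc_prob \<rho> D U n a b = image_prob \<kappa> T (push \<kappa> \<rho> D) (kernel_mult \<kappa> U D) n a b"
        using eq ab by blast
      also have "ennreal \<dots> = emeasure (pca_zigzag \<kappa> T m) (cylinder \<kappa> i0 n a b)"
        by (rule pca_zigzag_hzmc[OF law T D U \<rho>, symmetric]) (rule ab)
      finally show ?thesis .
    qed
  qed
qed

theorem theorem2p3:
  fixes \<kappa> :: nat
    and T :: "nat \<times> nat \<Rightarrow> nat \<Rightarrow> real"
    and D U :: "nat \<Rightarrow> nat \<Rightarrow> real"
    and \<rho> :: "nat \<Rightarrow> real"
    and m :: "((int \<Rightarrow> nat) \<times> (int \<Rightarrow> nat)) measure"
  assumes "\<kappa> \<ge> 1"
    and "transition_matrix \<kappa> T"
    and "markov_kernel \<kappa> D"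
    and "markov_kernel \<kappa> U"
    and "\<forall>a\<le>\<kappa>. \<forall>b\<le>\<kappa>. kernel_mult \<kappa> D U a b > 0"
    and "invariant_probability \<kappa> (kernel_mult \<kappa> D U) \<rho>"
    and "hzmc_law \<kappa> \<rho> D U m"
  shows "pca_zigzag \<kappa> T m = m \<longleftrightarrow>
    (\<forall>a\<le>\<kappa>. \<forall>b\<le>\<kappa>. \<forall>c\<le>\<kappa>.
       (T (a, b) c > 0 \<longrightarrow> T (a, b) c = D a c * U c b / kernel_mult \<kappa> D U a b) \<and>
       (T (a, b) c = 0 \<longrightarrow> D a c * U c b = 0)) \<and>
    (\<forall>a\<le>\<kappa>. \<forall>b\<le>\<kappa>. kernel_mult \<kappa> D U a b = kernel_mult \<kappa> U D a b)"
    (is "_ \<longleftrightarrow> ?cond1 \<and> ?cond2")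
proof -
  note T = assms(2) and D = assms(3) and U = assms(4) and \<rho> = assms(6)
  have pos: "0 < kernel_mult \<kappa> D U a b" if "a \<le> \<kappa>" "b \<le> \<kappa>" for a b
    using assms(5) that by simp
  \<comment> \<open>For a positive entry of T, multiply by (DU)(a, b) > 0; for a zero entry, both
    sides say that D(a, c) U(c, b) vanishes.\<close>
  have cond1: "?cond1 \<longleftrightarrow> (\<forall>a\<le>\<kappa>. \<forall>b\<le>\<kappa>. \<forall>c\<le>\<kappa>. kernel_mult \<kappa> D U a b * T (a, b) c = D a c * U c b)"
  proof -
    have "((T (a, b) c > 0 \<longrightarrow> T (a, b) c = D a c * U c b / kernel_mult \<kappa> D U a b) \<and>
        (T (a, b) c = 0 \<longrightarrow> D a c * U c b = 0)) \<longleftrightarrow>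
      kernel_mult \<kappa> D U a b * T (a, b) c = D a c * U c b" if "a \<le> \<kappa>" "b \<le> \<kappa>" "c \<le> \<kappa>" for a b c
    proof -
      have "0 \<le> T (a, b) c" using T that by (simp add: transition_matrix_def)
      then show ?thesis
        using pos[OF that(1,2)] by (cases "T (a, b) c = 0") (auto simp: eq_divide_eq mult.commute)
    qed
    then show ?thesis by blast
  qed
  let ?eq = "\<lambda>n a b. hzmc_prob \<rho> D U n a b = image_prob \<kappa> T (push \<kappa> \<rho> D) (kernel_mult \<kappa> U D) n a b"
  have "(\<forall>n a b. (\<forall>i\<le>n. a i \<le> \<kappa> \<and> b i \<le> \<kappa>) \<longrightarrow> ?eq n a b) \<longleftrightarrow> ?cond1 \<and> ?cond2"
  proof
    assume *: "\<forall>n a b. (\<forall>i\<le>n. a i \<le> \<kappa> \<and> b i \<le> \<kappa>) \<longrightarrow> ?eq n a b"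
    have eq: "?eq n a b" if "\<And>i. i \<le> n \<Longrightarrow> a i \<le> \<kappa> \<and> b i \<le> \<kappa>" for n a b using * that by simp
    have \<rho>_pos: "0 < \<rho> a" if "a \<le> \<kappa>" for a
      using pos \<rho> that by (rule invariant_probability_pos)
    \<comment> \<open>The abstract kernel \<open>K\<close> is UD here, so the conclusion
      \<open>K = DU\<close> is condition (2).\<close>
    have kernel: "kernel_mult \<kappa> U D a b = kernel_mult \<kappa> D U a b" if "a \<le> \<kappa>" "b \<le> \<kappa>" for a b
      using T D U sum_kernel_mult[OF U D] \<rho>_pos eq that by (rule kernel_eq_of_image_prob_eq)
    have "kernel_mult \<kappa> U D a b * T (a, b) c = D a c * U c b" if "a \<le> \<kappa>" "b \<le> \<kappa>" "c \<le> \<kappa>" for a b c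
      using T D U sum_kernel_mult[OF U D] \<rho>_pos eq that by (rule transition_eq_of_image_prob_eq)
    then show "?cond1 \<and> ?cond2"
      unfolding cond1 by (simp add: kernel)
  next
    assume "?cond1 \<and> ?cond2"
    then have c1': "\<forall>a\<le>\<kappa>. \<forall>b\<le>\<kappa>. \<forall>c\<le>\<kappa>. kernel_mult \<kappa> D U a b * T (a, b) c = D a c * U c b" and ?cond2
      unfolding cond1 by blast+
    then have c2: "kernel_mult \<kappa> D U a b = kernel_mult \<kappa> U D a b" if "a \<le> \<kappa>" "b \<le> \<kappa>" for a b
      using that by blast
    have c1: "kernel_mult \<kappa> U D a b * T (a, b) c = D a c * U c b" if "a \<le> \<kappa>" "b \<le> \<kappa>" "c \<le> \<kappa>" for a b c
      unfolding c2[OF that(1,2), symmetric] using c1' that by blast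
    have "invariant_probability \<kappa> (kernel_mult \<kappa> D U) (push \<kappa> \<rho> D)"
      using D \<rho> c2 by (rule push_invariant)
    with pos have inv: "push \<kappa> \<rho> D a = \<rho> a" if "a \<le> \<kappa>" for a
      using \<rho> that by (rule invariant_probability_unique)
    show "\<forall>n a b. (\<forall>i\<le>n. a i \<le> \<kappa> \<and> b i \<le> \<kappa>) \<longrightarrow> ?eq n a b"
    proof (intro allI impI)
      fix n and a b :: "nat \<Rightarrow> nat" assume ab: "\<forall>i\<le>n. a i \<le> \<kappa> \<and> b i \<le> \<kappa>"
      \<comment> \<open>The initial law enters \<open>image_prob\<close> only through its value at
        \<open>a 0\<close>, a letter of the state set, where \<rho> D and \<rho> agree.\<close>
      have "image_prob \<kappa> T (push \<kappa> \<rho> D) (kernel_mult \<kappa> U D) n a b =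
          image_prob \<kappa> T \<rho> (kernel_mult \<kappa> U D) n a b"
        using inv[of "a 0"] ab by (simp add: image_prob_def)
      also have "\<dots> = hzmc_prob \<rho> D U n a b"
        using U c1 ab[rule_format] by (rule image_prob_eq_hzmc_prob)
      finally show "?eq n a b" ..
    qed
  qed
  then show ?thesis
    unfolding pca_zigzag_eq_iff[OF assms(7) T D U \<rho>] .
qed

end
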